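(* Let $E/\mathbb{Q}$ be an elliptic curve, let $m \ge 2$, and let $n = p_1 p_2 \cdots p_m$ be an elliptic Korselt number of Type I for $E$, where $p_1, \dots, p_m$ are primes with $5 \le p_1 < p_2 < \dots < p_m$. Then at least one of the following conditions is satisfied: (1) $p_1 \cdots p_{m-1} \le 4^m$; (2) $a_{p_m} = 1$, and among the indices $1 \le i \le m-1$, one has $a_{p_i} = -1$ for an even number (possibly zero) of values of $i$ and $a_{p_i} = 1$ for all the remaining values of $i$; (3) $p_1 \cdots p_{m-1} \ge \dfrac{\sqrt{p_m}}{4^m}$.
   Context: For an elliptic curve $E/\mathbb{Q}$ (given by a minimal Weierstrass equation) and a prime $p$ of good reduction, $a_p = p + 1 - \#E(\mathbb{F}_p)$. For a positive integer $n$, $a_n$ is the $n$-th coefficient of the $L$-series $L(E/\mathbb{Q},s) = \sum_{n\ge1} a_n n^{-s}$; in particular, for $n = p_1\cdots p_m$ a product of distinct primes, $a_n = a_{p_1}\cdots a_{p_m}$. $\operatorname{ord}_p(k)$ is the exponent of $p$ in $k$, with $\operatorname{ord}_p(0) = \infty$. A positive integer $n$ is an elliptic Korselt number of Type I for $E$ if $n$ has at least two distinct prime factors and for every prime $p$ dividing $n$: (i) $E$ has good reduction at $p$; (ii) $p + 1 - a_p$ divides $n + 1 - a_n$; (iii) $\operatorname{ord}_p(a_n - 1) \ge \operatorname{ord}_p(n) - \delta_p$, where $\delta_p = 1$ if $a_p \not\equiv 1 \pmod p$ and $\delta_p = 0$ if $a_p \equiv 1 \pmod p$. *)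

theory Defs
  imports Complex_Main "HOL-Library.Extended_Nat" "HOL-Computational_Algebra.Computational_Algebra"
begin

section \<open>Weierstrass equations\<close>

text \<open>The equation \<open>y\<^sup>2 + a1 x y + a3 y = x\<^sup>3 + a2 x\<^sup>2 + a4 x + a6\<close>.\<close>

datatype 'a weierstrass =
  Weierstrass (wa1: 'a) (wa2: 'a) (wa3: 'a) (wa4: 'a) (wa6: 'a)

definition weq :: "'a::comm_ring_1 weierstrass \<Rightarrow> 'a \<Rightarrow> 'a \<Rightarrow> 'a" where
  "weq E x y = y^2 + wa1 E * x * y + wa3 E * y
     - (x^3 + wa2 E * x^2 + wa4 E * x + wa6 E)"

text \<open>The partial derivatives of \<^const>\<open>weq\<close>.\<close>

definition weq_dx :: "'a::comm_ring_1 weierstrass \<Rightarrow> 'a \<Rightarrow> 'a \<Rightarrow> 'a" where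
  "weq_dx E x y = wa1 E * y - (3 * x^2 + 2 * wa2 E * x + wa4 E)"

definition weq_dy :: "'a::comm_ring_1 weierstrass \<Rightarrow> 'a \<Rightarrow> 'a \<Rightarrow> 'a" where
  "weq_dy E x y = 2 * y + wa1 E * x + wa3 E"

definition discriminant :: "'a::comm_ring_1 weierstrass \<Rightarrow> 'a" where
  "discriminant E =
     (let b2 = wa1 E ^ 2 + 4 * wa2 E;
          b4 = 2 * wa4 E + wa1 E * wa3 E;
          b6 = wa3 E ^ 2 + 4 * wa6 E;
          b8 = wa1 E ^ 2 * wa6 E + 4 * wa2 E * wa6 E - wa1 E * wa3 E * wa4 E
               + wa2 E * wa3 E ^ 2 - wa4 E ^ 2
      in - (b2 ^ 2 * b8) - 8 * b4 ^ 3 - 27 * b6 ^ 2 + 9 * b2 * b4 * b6)"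

text \<open>
  \<open>E'\<close> arises from \<open>E\<close> by an admissible change of variables over the rationals,
  \<open>x = u\<^sup>2 x' + r\<close>, \<open>y = u\<^sup>3 y' + u\<^sup>2 s x' + t\<close>. As the rationals are infinite, the
  pointwise identity below is an identity of polynomials.
\<close>

definition weierstrass_iso :: "rat weierstrass \<Rightarrow> rat weierstrass \<Rightarrow> bool" where
  "weierstrass_iso E E' \<longleftrightarrow> (\<exists>u r s t. u \<noteq> 0 \<and>
     (\<forall>x y. weq E (u^2 * x + r) (u^3 * y + u^2 * s * x + t) = u^6 * weq E' x y))"

definition rat_val :: "nat \<Rightarrow> rat \<Rightarrow> int" where
  "rat_val p q = int (multiplicity (int p) (fst (quotient_of q)))
               - int (multiplicity (int p) (snd (quotient_of q)))"

definition p_integral :: "nat \<Rightarrow> rat \<Rightarrow> bool" where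
  "p_integral p q \<longleftrightarrow> \<not> int p dvd snd (quotient_of q)"

text \<open>
  An elliptic curve over the rationals is given by a global minimal Weierstrass equation:
  the coefficients are integers and at every prime the valuation of the discriminant is
  minimal among all isomorphic equations that are integral at that prime.
\<close>

definition minimal_elliptic_curve :: "int weierstrass \<Rightarrow> bool" where
  "minimal_elliptic_curve E \<longleftrightarrow> discriminant E \<noteq> 0 \<and>
     (\<forall>p E'. prime p \<and> weierstrass_iso (map_weierstrass rat_of_int E) E' \<and>
             (\<forall>c \<in> set_weierstrass E'. p_integral p c) \<longrightarrow>
        rat_val p (rat_of_int (discriminant E)) \<le> rat_val p (discriminant E'))"


section \<open>Reduction modulo primes\<close>

text \<open>This and the following notions are meant for minimal equations.\<close>

definition good_reduction :: "int weierstrass \<Rightarrow> nat \<Rightarrow> bool" where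
  "good_reduction E p \<longleftrightarrow> \<not> int p dvd discriminant E"

text \<open>The number of points of the reduced curve; the summand 1 is the point at infinity.\<close>

definition num_points :: "int weierstrass \<Rightarrow> nat \<Rightarrow> nat" where
  "num_points E p =
     1 + card {(x, y). x \<in> {0..<int p} \<and> y \<in> {0..<int p} \<and> int p dvd weq E x y}"

definition singular_mod :: "int weierstrass \<Rightarrow> nat \<Rightarrow> int \<Rightarrow> int \<Rightarrow> bool" where
  "singular_mod E p x y \<longleftrightarrow>
     int p dvd weq E x y \<and> int p dvd weq_dx E x y \<and> int p dvd weq_dy E x y"

text \<open>
  At a singular point \<open>(x0, y0)\<close> of the reduced curve the quadratic part of the equation in
  \<open>X = x - x0\<close>, \<open>Y = y - y0\<close> is \<open>Y\<^sup>2 + a1 X Y - (3 x0 + a2) X\<^sup>2\<close>; its factors \<open>Y - t X\<close> are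
  the tangent lines. There are two distinct ones defined over the prime field if the reduction is
  split multiplicative, none if it is nonsplit multiplicative, and one double tangent,
  which is defined over the prime field, if it is additive.
\<close>

definition tangent_slopes :: "int weierstrass \<Rightarrow> nat \<Rightarrow> int \<Rightarrow> int set" where
  "tangent_slopes E p x0 =
     {t \<in> {0..<int p}. int p dvd t^2 + wa1 E * t - (3 * x0 + wa2 E)}"

definition split_multiplicative :: "int weierstrass \<Rightarrow> nat \<Rightarrow> bool" where
  "split_multiplicative E p \<longleftrightarrow>
     (\<exists>x y. singular_mod E p x y \<and> card (tangent_slopes E p x) = 2)"

definition nonsplit_multiplicative :: "int weierstrass \<Rightarrow> nat \<Rightarrow> bool" where
  "nonsplit_multiplicative E p \<longleftrightarrow>
     (\<exists>x y. singular_mod E p x y \<and> card (tangent_slopes E p x) = 0)"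


section \<open>Coefficients of the L-series\<close>

definition a_prime :: "int weierstrass \<Rightarrow> nat \<Rightarrow> int" where
  "a_prime E p =
     (if good_reduction E p then int p + 1 - int (num_points E p)
      else if split_multiplicative E p then 1
      else if nonsplit_multiplicative E p then -1
      else 0)"

text \<open>
  The coefficients of the inverse of the Euler factor at \<open>p\<close>, which is \<open>1 - a\<^sub>p T + p T\<^sup>2\<close> for
  good reduction and \<open>1 - a\<^sub>p T\<close> for bad reduction.
\<close>

fun a_prime_power :: "int weierstrass \<Rightarrow> nat \<Rightarrow> nat \<Rightarrow> int" where
  "a_prime_power E p 0 = 1"
| "a_prime_power E p (Suc 0) = a_prime E p"
| "a_prime_power E p (Suc (Suc k)) = a_prime E p * a_prime_power E p (Suc k)
     - (if good_reduction E p then int p else 0) * a_prime_power E p k"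

lemma euler_factor:
  "Abs_fps (a_prime_power E p) *
     (1 - fps_const (a_prime E p) * fps_X
        + fps_const (if good_reduction E p then int p else 0) * fps_X ^ 2) = 1"
    (is "?F * (1 - ?a * fps_X + ?c * fps_X ^ 2) = 1")
proof (rule fps_ext)
  fix n
  have "?F * (1 - ?a * fps_X + ?c * fps_X ^ 2) = ?F - ?a * (fps_X * ?F) + ?c * (fps_X ^ 2 * ?F)"
    by (simp add: algebra_simps)
  then show "(?F * (1 - ?a * fps_X + ?c * fps_X ^ 2)) $ n = 1 $ n"
    by (cases "(E, p, n)" rule: a_prime_power.cases) (auto simp: fps_X_power_mult_nth)
qed

text \<open>For positive \<open>n\<close>, the \<open>n\<close>-th coefficient of the Euler product.\<close>

definition a_coeff :: "int weierstrass \<Rightarrow> nat \<Rightarrow> int" where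
  "a_coeff E n = (\<Prod>p \<in> prime_factors n. a_prime_power E p (multiplicity p n))"

lemma a_coeff_prime: "prime p \<Longrightarrow> a_coeff E p = a_prime E p"
  by (simp add: a_coeff_def prime_factorization_prime)

lemma a_coeff_prod_primes:
  assumes "finite P" "\<And>p. p \<in> P \<Longrightarrow> prime p"
  shows "a_coeff E (\<Prod>P) = (\<Prod>p\<in>P. a_prime E p)"
proof -
  have m: "multiplicity q (\<Prod>P) = (if q \<in> P then 1 else 0)" if "prime q" for q
    using multiplicity_prod_prime_powers[of P q "\<lambda>_. 1"] assms that by simp
  have nz: "\<Prod>P \<noteq> 0"
    using assms by (auto dest: not_prime_0[THEN notE])
  have "prime_factors (\<Prod>P) = P"
    using m nz assms by (auto simp: prime_factors_multiplicity split: if_splits)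
  then show ?thesis
    unfolding a_coeff_def by (intro prod.cong) (use m assms in auto)
qed


section \<open>Elliptic Korselt numbers\<close>

definition ord_at :: "nat \<Rightarrow> int \<Rightarrow> enat" where
  "ord_at p k = (if k = 0 then \<infinity> else enat (multiplicity (int p) k))"

definition korselt_delta :: "int weierstrass \<Rightarrow> nat \<Rightarrow> enat" where
  "korselt_delta E p = (if a_prime E p mod int p = 1 mod int p then 0 else 1)"

definition elliptic_korselt_I :: "int weierstrass \<Rightarrow> nat \<Rightarrow> bool" where
  "elliptic_korselt_I E n \<longleftrightarrow> n > 0 \<and> card (prime_factors n) \<ge> 2 \<and>
     (\<forall>p. prime p \<and> p dvd n \<longrightarrow>
        good_reduction E p \<and>
        int p + 1 - a_prime E p dvd int n + 1 - a_coeff E n \<and>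
        ord_at p (a_coeff E n - 1) \<ge> ord_at p (int n) - korselt_delta E p)"

end

theory Submission
  imports Defs "Berlekamp_Zassenhaus.Finite_Field"
begin

text \<open>
  Let \<open>P\<close> be the product of the small primes, \<open>q\<close> the largest prime, \<open>a\<close> its coefficient and \<open>A\<close> the
  product of the other coefficients. The Korselt divisibility at \<open>q\<close>, read modulo \<open>q + 1 - a\<close>,
  says that \<open>q + 1 - a\<close> divides \<open>R = P (a - 1) + 1 - A a\<close>. By Hasse's bound, \<open>q + 1 - a\<close> is close to \<open>q\<close>,
  while \<open>R\<close> is at most of order \<open>P \<surd>q\<close>; so \<open>R \<noteq> 0\<close> makes \<open>P\<close> at least of order \<open>\<surd>q\<close>. If \<open>R = 0\<close>, then
  \<open>a (P - A) = P - 1\<close>; Hasse's bound for the small primes gives \<open>\<bar>A\<bar> < P / 2\<close> as soon as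
  \<open>P > 4\<^sup>m\<close>, which leaves only \<open>a = 1\<close> and \<open>A = 1\<close>, so all other coefficients are signs with product \<open>1\<close>.
  This part is \<open>large_prime_dichotomy\<close>.

  The deep ingredient is Hasse's bound \<open>a\<^sub>p\<^sup>2 \<le> 4 p\<close>, which is proved by Manin's elementary method. For
  \<open>f = t\<^sup>3 + a t + b\<close> over a field with \<open>q\<close> elements, consider the curve \<open>f(t) y\<^sup>2 = x\<^sup>3 + a x + b\<close> over the field
  of rational functions in \<open>t\<close>, with its points \<open>P\<^sub>0 = (t\<^sup>q, f\<^bsup>(q-1)/2\<^esup>)\<close> and \<open>Q = (t, 1)\<close>. Let \<open>d\<^sub>n\<close> be the
  degree of the numerator of the x-coordinate of \<open>P\<^sub>0 + n Q\<close>. Then \<open>d\<^sub>0 = q\<close>, a point count gives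
  \<open>d\<^sub>1 = q + 1 + (q - N)\<close> for the number \<open>N\<close> of affine points, and \<open>d\<^sub>n\<^sub>+\<^sub>1 - 2 d\<^sub>n + d\<^sub>n\<^sub>-\<^sub>1 = 2\<close>. Hence
  \<open>d\<^sub>n = n\<^sup>2 + (q - N) n + q\<close>. As this is nonnegative for all integers \<open>n\<close> and \<open>q\<close> is odd, the discriminant
  \<open>(q - N)\<^sup>2 - 4 q\<close> is not positive.

  Only x-coordinates have to be tracked: those of \<open>S\<close>, \<open>Q\<close> and \<open>S \<plusminus> Q\<close> satisfy a polynomial
  equation of degree two in the coordinate of \<open>S \<plusminus> Q\<close>, which is moreover symmetric in the
  coordinates of \<open>S\<close> and \<open>S \<plusminus> Q\<close>. The sequence of x-coordinates is produced by
  repeatedly passing to the other root (\<open>chord_next\<close>), and the second difference of the degrees is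
  read off from the coefficients (\<open>numerator_degrees_quadratic\<close>).
\<close>

section \<open>The symmetric biquadratic form of the chord construction\<close>

text \<open>
  On \<open>y\<^sup>2 = x\<^sup>3 + a x + b\<close> take a point \<open>Q\<close> with x-coordinate \<open>t\<close> and a point \<open>S\<close> with x-coordinate \<open>u / v\<close>. The
  two numbers \<open>x(S + Q)\<close> and \<open>x(S - Q)\<close> are the roots of \<open>chord_den z\<^sup>2 - chord_mid z + chord_num\<close>, and
  \<open>biquad\<close> is this quadratic form in homogeneous coordinates \<open>z = U / V\<close>. A quadratic twist changes
  the y-coordinates only, so the same form serves all twists.
\<close>

definition chord_den :: "'a::comm_ring_1 \<Rightarrow> 'a \<Rightarrow> 'a \<Rightarrow> 'a" where
  "chord_den t u v = (u - t * v)^2"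

definition chord_mid :: "'a::comm_ring_1 \<Rightarrow> 'a \<Rightarrow> 'a \<Rightarrow> 'a \<Rightarrow> 'a \<Rightarrow> 'a" where
  "chord_mid a b t u v = 2 * ((t * u + a * v) * (u + t * v) + 2 * b * v^2)"

definition chord_num :: "'a::comm_ring_1 \<Rightarrow> 'a \<Rightarrow> 'a \<Rightarrow> 'a \<Rightarrow> 'a \<Rightarrow> 'a" where
  "chord_num a b t u v = (t * u - a * v)^2 - 4 * b * v * (u + t * v)"

definition biquad :: "'a::comm_ring_1 \<Rightarrow> 'a \<Rightarrow> 'a \<Rightarrow> 'a \<Rightarrow> 'a \<Rightarrow> 'a \<Rightarrow> 'a \<Rightarrow> 'a" where
  "biquad a b t u v U V =
     chord_den t u v * U^2 - chord_mid a b t u v * U * V + chord_num a b t u v * V^2"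

text \<open>
  The points \<open>S\<close> and \<open>S \<plusminus> Q\<close> differ by \<open>\<plusminus>Q\<close>, a relation in which they play the same role. This symmetry is
  what lets the passage to the other root be iterated.
\<close>

lemma biquad_commute: "biquad a b t u v U V = biquad a b t U V u v"
  for a b t u v U V :: "'a::idom"
  unfolding biquad_def chord_den_def chord_mid_def chord_num_def
  by (simp add: algebra_simps power_numeral_reduce)

text \<open>
  Modulo \<open>u - t v\<close>, where the two x-coordinates meet, the remaining coefficients become expressions
  in \<open>f(t)\<close> and \<open>f'(t)\<close>, as in the tangent (duplication) formula.
\<close>

lemma chord_num_tangent:
  "chord_num a b t u v = v^2 * ((3 * t^2 + a)^2 - 8 * t * (t^3 + a * t + b))
     + (u - t * v) * (t * (t * u + t^2 * v - 2 * a * v) - 4 * b * v)"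
  for a b t u v :: "'a::idom"
  unfolding chord_num_def
  by (simp add: algebra_simps power_numeral_reduce)

lemma chord_mid_tangent:
  "chord_mid a b t u v = 4 * v^2 * (t^3 + a * t + b)
     + (u - t * v) * (2 * (t * (u + t * v) + t^2 * v + a * v))"
  for a b t u v :: "'a::idom"
  unfolding chord_mid_def by (simp add: algebra_simps power_numeral_reduce)

lemma discriminant_bezout:
  "4 * a^3 + 27 * b^2 = (27 * b - 18 * a * t) * (t^3 + a * t + b)
     + (6 * a * t^2 - 9 * b * t + 4 * a^2) * (3 * t^2 + a)" for a b t :: "'a::idom"
  by (simp add: algebra_simps power_numeral_reduce)

text \<open>
  A prime dividing all three coefficients would divide \<open>u - t v\<close>, hence by the tangent formulas
  both \<open>f(t)\<close> and \<open>f'(t)\<close>, hence the discriminant. So no cancellation occurs in the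
  recursion, which is why degrees can be computed exactly.
\<close>

lemma chord_coeffs_no_common_prime:
  fixes a b t u v :: "'a::factorial_ring_gcd"
  assumes "coprime u v" and "prime_elem d"
    and two: "\<not> d dvd 2" and disc: "\<not> d dvd 4 * a^3 + 27 * b^2"
    and den: "d dvd chord_den t u v" and mid: "d dvd chord_mid a b t u v"
    and num: "d dvd chord_num a b t u v"
  shows False
proof -
  have w: "d dvd u - t * v"
    using den assms(2) unfolding chord_den_def by (rule prime_elem_dvd_power[rotated])
  have v: "\<not> d dvd v"
  proof
    assume "d dvd v"
    moreover from this w have "d dvd u"
      by (metis dvd_add_right_iff dvd_mult diff_add_cancel add.commute)
    ultimately show False
      using assms(1,2) by (meson coprime_common_divisor not_prime_elem_zero prime_elem_not_unit)
  qed
  have "d dvd 4 * v^2 * (t^3 + a * t + b)"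
    using mid w unfolding chord_mid_tangent by (simp add: dvd_add_left_iff)
  then have "d dvd 2 * 2 * v^2 * (t^3 + a * t + b)"
    by simp
  then have f: "d dvd t^3 + a * t + b"
    using two v assms(2) by (metis prime_elem_dvd_mult_iff prime_elem_dvd_power)
  have "d dvd v^2 * ((3 * t^2 + a)^2 - 8 * t * (t^3 + a * t + b))"
    using num w unfolding chord_num_tangent by (simp add: dvd_add_left_iff)
  then have "d dvd (3 * t^2 + a)^2 - 8 * t * (t^3 + a * t + b)"
    using v assms(2) by (metis prime_elem_dvd_mult_iff prime_elem_dvd_power)
  then have "d dvd (3 * t^2 + a)^2"
    using f by (metis dvd_add_right_iff dvd_mult diff_add_cancel add.commute)
  then have "d dvd 3 * t^2 + a"
    using assms(2) by (metis prime_elem_dvd_power)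
  then have "d dvd 4 * a^3 + 27 * b^2"
    unfolding discriminant_bezout[of a b t] using f by (simp add: dvd_add)
  then show False
    using disc by blast
qed

text \<open>
  Passing to the other root: a quadratic form with a root \<open>(u : v)\<close> in lowest terms splits into the
  linear forms of \<open>(u : v)\<close> and of a second point \<open>(u' : v')\<close>, without denominators.
\<close>

lemma chord_next:
  fixes a b t u v U V :: "'a::factorial_ring_gcd"
  assumes "coprime u v" and "coprime U V" and "u \<noteq> 0"
    and num: "chord_num a b t U V \<noteq> 0"
    and two: "is_unit (2::'a)" and disc: "is_unit (4 * a^3 + 27 * b^2)"
    and root: "biquad a b t U V u v = 0"
  obtains u' v' where "coprime u' v'"
    and "chord_den t U V = v * v'" and "chord_num a b t U V = u * u'"
    and "chord_mid a b t U V = u * v' + u' * v"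
    and "biquad a b t U V u' v' = 0"
proof -
  define D where "D = chord_den t U V"
  define M where "M = chord_mid a b t U V"
  define N where "N = chord_num a b t U V"
  have eq: "D * u^2 - M * u * v + N * v^2 = 0"
    using root unfolding biquad_def D_def M_def N_def by simp
  have "\<exists>u' v'. D = v * v' \<and> N = u * u' \<and> M = u * v' + u' * v"
  proof (cases "v = 0")
    case True
    then have "is_unit u"
      using assms(1) by simp
    then obtain i where i: "1 = u * i"
      by (rule dvdE)
    have "D = 0"
      using eq True assms(3) by simp
    moreover have "x = u * (x * i)" for x
      using i by (metis mult.left_commute mult.right_neutral)
    ultimately have "D = v * (M * i) \<and> N = u * (N * i) \<and> M = u * (M * i) + (N * i) * v"
      using True by simp
    then show ?thesis
      by blast
  next
    case False
    have "D * u^2 = v * (M * u - N * v) + (D * u^2 - M * u * v + N * v^2)"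
      "N * v^2 = u * (M * v - D * u) + (D * u^2 - M * u * v + N * v^2)"
      by (simp_all add: algebra_simps power2_eq_square)
    then have "D * u^2 = v * (M * u - N * v)" "N * v^2 = u * (M * v - D * u)"
      unfolding eq by simp_all
    then have "v dvd D * u^2" "u dvd N * v^2"
      by (metis dvd_triv_left)+
    then have "v dvd D" "u dvd N"
      using assms(1)
      by (simp_all add: coprime_dvd_mult_left_iff coprime_commute)
    then obtain v' u' where D: "D = v * v'" and N: "N = u * u'"
      by (elim dvdE)
    have "u * v * (u * v' + u' * v - M) = v * v' * u^2 - M * u * v + u * u' * v^2"
      by (simp add: algebra_simps power2_eq_square)
    then have "u * v * (u * v' + u' * v - M) = 0"
      using eq unfolding D N by simp
    then have "M = u * v' + u' * v"
      using False assms(3) by simp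
    then show ?thesis
      using D N by blast
  qed
  then obtain u' v' where D: "D = v * v'" and N: "N = u * u'" and M: "M = u * v' + u' * v"
    by blast
  have "coprime u' v'"
  proof (rule ccontr)
    assume not_coprime: "\<not> coprime u' v'"
    then obtain c where c: "c dvd u'" "c dvd v'" "\<not> is_unit c"
      by (rule not_coprimeE)
    have "c \<noteq> 0"
      using num c(1) N unfolding N_def by auto
    then obtain d where d: "prime_elem d" "d dvd u'" "d dvd v'"
      using c by (metis prime_divisor_exists dvd_trans prime_imp_prime_elem)
    show False
    proof (rule chord_coeffs_no_common_prime)
      show "coprime U V" "prime_elem d" by fact+
      show "\<not> d dvd 2" "\<not> d dvd 4 * a^3 + 27 * b^2"
        using two disc d(1) by (meson dvd_trans prime_elem_not_unit)+
      show "d dvd chord_den t U V" "d dvd chord_mid a b t U V" "d dvd chord_num a b t U V"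
        using d(2,3) unfolding D_def[symmetric] M_def[symmetric] N_def[symmetric] D M N by simp_all
    qed
  qed
  moreover have "biquad a b t U V u' v' = 0"
    unfolding biquad_def D_def[symmetric] M_def[symmetric] N_def[symmetric] D M N
    by (simp add: algebra_simps power2_eq_square)
  ultimately show thesis
    using that D N M unfolding D_def M_def N_def by blast
qed

section \<open>Degrees along the sequence of x-coordinates\<close>

text \<open>
  The fraction \<open>u / v\<close> has a pole at infinity; \<open>v = 0\<close> stands for the point at infinity of the curve. Such
  points are those that reduce to the neutral element at the infinite place, so adding \<open>Q\<close> preserves
  the condition. It also makes the degree of the numerator the height of the fraction.
\<close>

definition pole_at_infinity :: "'a::zero poly \<Rightarrow> 'a poly \<Rightarrow> bool" where
  "pole_at_infinity u v \<longleftrightarrow> u \<noteq> 0 \<and> (v = 0 \<or> degree v < degree u)"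

lemma chord_num_expand:
  "chord_num a b t u v = (t * u)^2 + v * (a^2 * v - 2 * a * (t * u) - 4 * b * u - 4 * b * (t * v))"
  for a b t u v :: "'a::idom"
  unfolding chord_num_def
  by (simp add: algebra_simps power_numeral_reduce)

text \<open>
  The square \<open>(t u)\<^sup>2\<close> dominates the numerator coefficient. The summand \<open>2\<close> in the degree is the second
  difference of the sequence of degrees.
\<close>

lemma degree_chord_num:
  fixes a b :: "'a::field" and u v :: "'a poly"
  assumes "pole_at_infinity u v"
  shows "degree (chord_num [:a:] [:b:] [:0, 1:] u v) = 2 * degree u + 2"
proof -
  let ?t = "[:0, 1:] :: 'a poly"
  define R where "R = v * ([:a^2:] * v - [:2 * a:] * (?t * u) - [:4 * b:] * u - [:4 * b:] * (?t * v))"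
  have split: "chord_num [:a:] [:b:] ?t u v = (?t * u)^2 + R"
  proof -
    have c: "[:a^2:] = [:a:]^2" "[:2 * a:] = 2 * [:a:]" "[:4 * b:] = 4 * [:b:]"
      by (simp_all add: power2_eq_square numeral_poly)
    show ?thesis
      unfolding R_def c by (rule chord_num_expand)
  qed
  have u: "u \<noteq> 0"
    using assms by (simp add: pole_at_infinity_def)
  have lead: "degree ((?t * u)^2) = 2 * degree u + 2"
    using u by (simp add: degree_power_eq degree_mult_eq)
  have "degree R < 2 * degree u + 2"
  proof (cases "v = 0")
    case False
    then have v: "degree v < degree u"
      using assms by (simp add: pole_at_infinity_def)
    let ?S = "[:a^2:] * v - [:2 * a:] * (?t * u) - [:4 * b:] * u - [:4 * b:] * (?t * v)"
    have "degree ?S \<le> degree u + 1"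
      using v by (intro degree_diff_le order.trans[OF degree_mult_le]) (auto simp: degree_mult_eq)
    then show ?thesis
      unfolding R_def using v degree_mult_le[of v ?S] by linarith
  qed (simp add: R_def)
  then show ?thesis
    unfolding split lead[symmetric] by (rule degree_add_eq_left)
qed

lemma degree_chord_mid:
  fixes a b :: "'a::field" and u v :: "'a poly"
  assumes "pole_at_infinity u v"
  shows "degree (chord_mid [:a:] [:b:] [:0, 1:] u v) < 2 * degree u + 2"
proof -
  let ?t = "[:0, 1:] :: 'a poly"
  have deg: "degree (?t * u) \<le> degree u + 1" "degree (?t * v) \<le> degree u" "degree v \<le> degree u"
    using assms degree_mult_le[of ?t u] degree_mult_le[of ?t v]
    by (auto simp: pole_at_infinity_def)
  have c: "2 * ((?t * u + [:a:] * v) * (u + ?t * v) + 2 * [:b:] * v^2)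
      = [:2:] * ((?t * u + [:a:] * v) * (u + ?t * v)) + [:4 * b:] * (v * v)"
  proof -
    have "(2 :: 'a poly) = [:2:]" "[:4 * b:] = 2 * 2 * [:b:]"
      by (simp_all add: numeral_poly)
    then show ?thesis
      by (simp only: distrib_left power2_eq_square mult.assoc)
  qed
  have "degree (?t * u + [:a:] * v) \<le> degree u + 1" "degree (u + ?t * v) \<le> degree u"
    using deg by (auto intro!: degree_add_le order.trans[OF degree_mult_le])
  then have "degree ([:2:] * ((?t * u + [:a:] * v) * (u + ?t * v))) \<le> 2 * degree u + 1"
    using degree_mult_le[of "?t * u + [:a:] * v" "u + ?t * v"]
      degree_mult_le[of "[:2:]" "(?t * u + [:a:] * v) * (u + ?t * v)"]
    by (simp del: mult_pCons_left mult_pCons_right)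
  moreover have "degree ([:4 * b:] * (v * v)) \<le> 2 * degree u + 1"
    using degree_mult_le[of v v] degree_mult_le[of "[:4 * b:]" "v * v"] deg(3)
    by (simp del: mult_pCons_left mult_pCons_right)
  ultimately have "degree (2 * ((?t * u + [:a:] * v) * (u + ?t * v) + 2 * [:b:] * v^2))
      \<le> 2 * degree u + 1"
    unfolding c by (rule degree_add_le)
  then show ?thesis
    unfolding chord_mid_def by simp
qed

text \<open>
  Starting from consecutive points \<open>u / v\<close> and \<open>U / V\<close>, the right-hand side is the degree of the
  numerator after \<open>n\<close> steps. The recursion \<open>degree u + degree u' = 2 degree U + 2\<close> comes from
  \<open>chord_num = u u'\<close>, and the induction slides the window of two points along the sequence.
\<close>

lemma numerator_degrees_quadratic:
  fixes a b :: "'a::field_gcd" and u v U V :: "'a poly"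
  assumes two: "(2::'a) \<noteq> 0" and disc: "4 * a^3 + 27 * b^2 \<noteq> 0"
    and "coprime u v" and "coprime U V"
    and "pole_at_infinity u v" and "pole_at_infinity U V"
    and "biquad [:a:] [:b:] [:0, 1:] U V u v = 0"
  shows "0 \<le> int (degree u) + int n * (int (degree U) - int (degree u)) + int n * (int n - 1)"
  using assms(3-)
proof (induction n arbitrary: u v U V)
  case (Suc n)
  let ?t = "[:0, 1:] :: 'a poly" and ?a = "[:a:]" and ?b = "[:b:]"
  have num: "degree (chord_num ?a ?b ?t U V) = 2 * degree U + 2"
    and mid: "degree (chord_mid ?a ?b ?t U V) < 2 * degree U + 2"
    using Suc.prems(4) by (rule degree_chord_num, rule degree_chord_mid)
  have u: "u \<noteq> 0"
    using Suc.prems(3) by (simp add: pole_at_infinity_def)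
  have num0: "chord_num ?a ?b ?t U V \<noteq> 0"
    using num by force
  have two_unit: "is_unit (2 :: 'a poly)"
    using two by (simp add: numeral_poly is_unit_const_poly_iff dvd_field_iff)
  have disc_const: "4 * ?a^3 + 27 * ?b^2 = [:4 * a^3 + 27 * b^2:]"
    by (simp add: numeral_poly power2_eq_square power3_eq_cube)
  have disc_unit: "is_unit (4 * ?a^3 + 27 * ?b^2)"
    using disc unfolding disc_const by (simp add: is_unit_const_poly_iff dvd_field_iff)
  obtain u' v' where cop: "coprime u' v'"
    and num_eq: "chord_num ?a ?b ?t U V = u * u'"
    and mid_eq: "chord_mid ?a ?b ?t U V = u * v' + u' * v"
    and root: "biquad ?a ?b ?t U V u' v' = 0"
    using chord_next[OF Suc.prems(1,2) u num0 two_unit disc_unit Suc.prems(5)] by metis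
  have u': "u' \<noteq> 0"
    using num_eq num0 by auto
  have deg: "degree u + degree u' = 2 * degree U + 2"
    using num num_eq u u' by (simp add: degree_mult_eq)
  \<comment> \<open>If \<open>v'\<close> were too big, \<open>u v'\<close> could not be cancelled in \<open>chord_mid = u v' + u' v\<close>, whose degree is small.\<close>
  have pole: "pole_at_infinity u' v'"
  proof (cases "v' = 0")
    case False
    have "degree (u' * v) < degree u + degree u'"
      using Suc.prems(3) u u' deg by (cases "v = 0") (auto simp: pole_at_infinity_def degree_mult_eq)
    moreover have "u * v' = chord_mid ?a ?b ?t U V - u' * v"
      using mid_eq by simp
    ultimately have "degree (u * v') < degree u + degree u'"
      using mid deg by (metis degree_diff_less)
    then show ?thesis
      using False u u' by (simp add: pole_at_infinity_def degree_mult_eq)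
  qed (simp add: pole_at_infinity_def u')
  have "0 \<le> int (degree U) + int n * (int (degree u') - int (degree U)) + int n * (int n - 1)"
    using Suc.prems(2) cop Suc.prems(4) pole root[unfolded biquad_commute[of _ _ _ U V]]
    by (rule Suc.IH)
  moreover have "int (degree u') = 2 * int (degree U) + 2 - int (degree u)"
    using deg by linarith
  ultimately show ?case
    by (simp add: algebra_simps)
qed simp

section \<open>Finite fields\<close>

lemma freshmans_dream:
  fixes x y :: "'a::comm_semiring_1"
  assumes "prime CHAR('a)"
  shows "(x + y) ^ CHAR('a) = x ^ CHAR('a) + y ^ CHAR('a)"
proof -
  let ?p = "CHAR('a)"
  have "of_nat (?p choose k) * x ^ k * y ^ (?p - k) = 0" if "k \<in> {1..<?p}" for k
  proof -
    have "?p dvd ?p choose k"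
      using that assms by (intro dvd_choose_prime) auto
    then show ?thesis
      by (metis of_nat_eq_0_iff_char_dvd mult_zero_left)
  qed
  then have middle: "(\<Sum>k\<in>{1..<?p}. of_nat (?p choose k) * x ^ k * y ^ (?p - k)) = 0"
    by (intro sum.neutral) blast
  have "{..?p} = insert 0 (insert ?p {1..<?p})"
    using assms prime_gt_0_nat by auto
  then have "(x + y) ^ ?p = y ^ ?p + (x ^ ?p 
      + (\<Sum>k\<in>{1..<?p}. of_nat (?p choose k) * x ^ k * y ^ (?p - k)))"
    using prime_gt_0_nat[OF assms] by (simp add: binomial_ring)
  then show ?thesis
    unfolding middle by (simp add: add.commute)
qed

lemma prod_linear_UNIV:
  "(\<Prod>r\<in>UNIV. [:- r, 1:]) = [:0, 1:] ^ CARD('a) - ([:0, 1:] :: 'a::finite_field poly)"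
    (is "?L = ?R")
proof (rule poly_eqI_degree_lead_coeff)
  have q: "CARD('a) > 1"
    using card_mono[of "UNIV :: 'a set" "{0, 1}"] by simp
  have degX: "degree ([:0, 1:] ^ CARD('a) :: 'a poly) = CARD('a)"
    by (simp add: degree_power_eq)
  have degL: "degree ?L = CARD('a)"
    by (subst degree_prod_eq_sum_degree) simp_all
  show "degree ?L \<le> CARD('a)" "degree ?R \<le> CARD('a)"
    using degL degX q by (auto intro!: degree_diff_le)
  have "poly.coeff ?L CARD('a) = 1"
    using lead_coeff_prod[of "\<lambda>r. [:- r, 1:]" "UNIV :: 'a set"] degL by simp
  moreover have "poly.coeff ?R CARD('a) = 1"
    using lead_coeff_power[of "[:0, 1:] :: 'a poly" "CARD('a)"] degX q
    by (simp add: coeff_eq_0)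
  ultimately show "poly.coeff ?L CARD('a) = poly.coeff ?R CARD('a)"
    by simp
  show "CARD('a) \<le> card (UNIV :: 'a set)"
    by simp
  show "poly ?L z = poly ?R z" for z
    by (auto simp: poly_prod finite_field_power_card_eq_same prod_zero_iff)
qed

text \<open>
  Euler's criterion: the squares of nonzero elements are roots of \<open>c\<^sup>h - 1\<close> and there are at least \<open>h\<close>
  of them, so they are all the roots.
\<close>

lemma card_square_roots:
  fixes c :: "'a::finite_field"
  assumes q: "CARD('a) = 2 * h + 1" and two: "(2::'a) \<noteq> 0"
  shows "card {y. y^2 = c} = (if c = 0 then 1 else if c ^ h = 1 then 2 else 0)"
proof -
  have fermat: "y ^ (2 * h) = 1" if "y \<noteq> 0" for y :: 'a
    using finite_field_power_card_eq_same[of y] that unfolding q by simp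
  have two_roots: "card {z. z^2 = y^2} = 2" if "y \<noteq> 0" for y :: 'a
  proof -
    have "{z. z^2 = y^2} = {y, - y}"
      by (auto simp: power2_eq_iff)
    moreover have "y \<noteq> - y"
      using that two by (simp add: eq_neg_iff_add_eq_0 mult_2[symmetric])
    ultimately show ?thesis
      by simp
  qed
  define S where "S = (\<lambda>y. y^2) ` (UNIV - {0 :: 'a})"
  have "S \<subseteq> {c. c ^ h = 1}"
    using fermat by (auto simp: S_def power_mult[symmetric])
  moreover have "card {c :: 'a. c ^ h = 1} \<le> card S"
  proof -
    have "card (UNIV - {0 :: 'a}) = (\<Sum>y \<in> UNIV - {0 :: 'a}. 1)"
      by (rule card_eq_sum)
    also have "\<dots> = (\<Sum>s\<in>S. \<Sum>y \<in> {y \<in> UNIV - {0}. y^2 = s}. 1)"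
      unfolding S_def by (rule sum.image_gen) simp
    also have "\<dots> \<le> (\<Sum>s\<in>S. 2)"
    proof (rule sum_mono)
      fix s
      assume "s \<in> S"
      then obtain y where "y \<noteq> 0" "s = y^2"
        by (auto simp: S_def)
      then have "card {z. z^2 = s} = 2"
        by (simp add: two_roots)
      then show "(\<Sum>y \<in> {y \<in> UNIV - {0}. y^2 = s}. 1) \<le> (2::nat)"
        using card_mono[of "{z. z^2 = s}" "{y \<in> UNIV - {0}. y^2 = s}"]
        by (simp add: Collect_mono)
    qed
    finally have "h \<le> card S"
      using q by (simp add: card_Diff_singleton)
    moreover have "card {c :: 'a. c ^ h = 1} \<le> h"
    proof -
      let ?P = "[:0, 1:] ^ h - 1 :: 'a poly"
      have deg: "degree ([:0, 1:] ^ h :: 'a poly) = h"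
        by (simp add: degree_power_eq)
      have "h > 0"
        using q card_mono[of "UNIV :: 'a set" "{0, 1}"] by simp
      then have "?P \<noteq> 0"
        using deg by (metis degree_1 less_irrefl right_minus_eq)
      then have "card {c. poly ?P c = 0} \<le> degree ?P"
        by (rule card_poly_roots_bound)
      moreover have "degree ?P \<le> h"
        using deg by (intro degree_diff_le) simp_all
      ultimately show ?thesis
        by simp
    qed
    ultimately show ?thesis
      by simp
  qed
  ultimately have S: "S = {c. c ^ h = 1}"
    by (intro card_seteq) simp_all
  show ?thesis
  proof (cases "c = 0")
    case False
    show ?thesis
    proof (cases "c ^ h = 1")
      case True
      then obtain y where "y \<noteq> 0" "c = y^2"
        using S by (force simp: S_def)
      then show ?thesis
        using True False by (simp add: two_roots)
    next
      case nonsquare: False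
      then have "{y. y^2 = c} = {}"
        using False S by (force simp: S_def)
      then show ?thesis
        using False nonsquare by (metis card.empty)
    qed
  qed simp
qed

section \<open>The initial points\<close>

text \<open>
  A quadratic polynomial that is nonnegative at all integers can have positive discriminant only if
  both roots lie between two consecutive integers \<open>k\<close> and \<open>k + 1\<close>. As the discriminant is an integer, the roots
  are then equal to these integers, and their product \<open>q\<close> is even.
\<close>

lemma quadratic_nonneg_on_ints_imp_disc_nonpos:
  fixes A q :: int
  assumes "odd q"
    and pos: "\<And>n::nat. 0 \<le> q + A * int n + int n ^ 2"
    and neg: "\<And>n::nat. 0 \<le> q - A * int n + int n ^ 2"
  shows "A^2 \<le> 4 * q"
proof -
  define k where "k = \<bar>A\<bar> div 2"
  have "0 \<le> q - \<bar>A\<bar> * int (nat k) + int (nat k) ^ 2"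
    using pos[of "nat k"] neg[of "nat k"] by (cases "A \<ge> 0") auto
  then have k: "0 \<le> q - \<bar>A\<bar> * k + k^2"
    by (simp add: k_def)
  show ?thesis
  proof (cases "even A")
    case True
    then have A: "\<bar>A\<bar> = 2 * k"
      by (simp add: k_def)
    have "k^2 \<le> q"
      using k unfolding A by (simp add: power2_eq_square)
    moreover have "A^2 = 4 * k^2"
      using A power2_abs[of A] by (simp add: power2_eq_square)
    ultimately show ?thesis
      by simp
  next
    case False
    then have A: "\<bar>A\<bar> = 2 * k + 1"
      unfolding k_def by presburger
    have "k * (k + 1) \<le> q"
      using k unfolding A by (simp add: power2_eq_square algebra_simps)
    moreover have "even (k * (k + 1))"
      by simp
    ultimately have "k * (k + 1) < q"
      using \<open>odd q\<close> by (cases "k * (k + 1) = q") auto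
    moreover have "A^2 = 4 * (k * (k + 1)) + 1"
      using power2_abs[of A] unfolding A by (simp add: power2_eq_square algebra_simps)
    ultimately show ?thesis
      by simp
  qed
qed

lemma prod_dvd_of_coprime:
  fixes g :: "'i \<Rightarrow> 'a::semiring_gcd"
  assumes "finite S" and "\<And>i. i \<in> S \<Longrightarrow> g i dvd c"
    and "\<And>i j. i \<in> S \<Longrightarrow> j \<in> S \<Longrightarrow> i \<noteq> j \<Longrightarrow> coprime (g i) (g j)"
  shows "prod g S dvd c"
  using assms
proof (induction S)
  case (insert i S)
  have "coprime (g i) (prod g S)"
    using insert.prems(2) insert.hyps(2) by (intro prod_coprime_right) auto
  then show ?case
    using insert by (simp add: divides_mult)
qed simp

lemma prime_elem_linear: "prime_elem [:- r, 1:]" for r :: "'a::field_gcd"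
  by (rule prime_elem_linear_poly) simp_all

lemma coprime_linear_iff: "coprime [:- r, 1:] p \<longleftrightarrow> poly p r \<noteq> 0" for r :: "'a::field_gcd"
  by (metis coprime_common_divisor dvd_refl poly_eq_0_iff_dvd prime_elem_imp_coprime
      prime_elem_linear prime_elem_not_unit)

lemma biquad_scale: "biquad a b t u v (g * U) (g * V) = g^2 * biquad a b t u v U V"
  for a b t u v g U V :: "'a::idom"
  unfolding biquad_def by (simp add: algebra_simps power2_eq_square)

text \<open>
  For a point \<open>(x, y)\<close> on the twist \<open>f(t) y\<^sup>2 = x\<^sup>3 + a x + b\<close>, the left-hand side over \<open>(x - t)\<^sup>2\<close> is the
  x-coordinate of \<open>(x, y) + (t, 1)\<close> by the chord construction. The left form shows its zeros, the right
  form its degree.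
\<close>

lemma chord_numerator:
  fixes a b t x y :: "'a::idom"
  defines "f \<equiv> t^3 + a * t + b"
  assumes curve: "f * y^2 = x^3 + a * x + b"
  shows "f * (y - 1)^2 - (x + t) * (x - t)^2 = (t * x + a) * (x + t) + 2 * b - 2 * f * y"
proof -
  have "f * (y - 1)^2 = f * y^2 - 2 * f * y + f"
    by (simp add: power2_eq_square algebra_simps)
  then show ?thesis
    unfolding curve by (simp add: f_def algebra_simps power_numeral_reduce)
qed

text \<open>
  As a quadratic equation for its last two arguments, \<open>biquad a b t x 1\<close> has a quarter of its discriminant
  equal to \<open>4 f(t) f(x)\<close>, which is the square of \<open>2 f(t) y\<close> by the equation of the twist.
\<close>

lemma biquad_chord:
  fixes a b t x y :: "'a::idom"
  defines "f \<equiv> t^3 + a * t + b"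
  assumes curve: "f * y^2 = x^3 + a * x + b"
  shows "biquad a b t x 1 (f * (y - 1)^2 - (x + t) * (x - t)^2) ((x - t)^2) = 0"
proof -
  define s where "s = (t * x + a) * (x + t) + 2 * b"
  have N: "f * (y - 1)^2 - (x + t) * (x - t)^2 = s - 2 * f * y"
    using curve unfolding s_def f_def by (rule chord_numerator)
  have disc: "s^2 - chord_num a b t x 1 * (x - t)^2 = 4 * f * (x^3 + a * x + b)"
    unfolding s_def f_def chord_num_def
  by (simp add: algebra_simps power_numeral_reduce)
  have quad: "w * (s - z)^2 - 2 * s * (s - z) * w + c * w^2 = w * (z^2 - (s^2 - c * w))"
    for w z c :: 'a
    by (simp add: algebra_simps power2_eq_square)
  have coeffs: "chord_den t x 1 = (x - t)^2" "chord_mid a b t x 1 = 2 * s"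
    by (simp_all add: chord_den_def chord_mid_def s_def)
  have "(2 * f * y)^2 = 4 * f * (x^3 + a * x + b)"
    unfolding curve[symmetric] by (simp add: power2_eq_square)
  then show ?thesis
    unfolding N biquad_def coeffs quad disc by simp
qed

section \<open>Hasse's bound for short Weierstrass equations\<close>

text \<open>
  The sequence of x-coordinates starts with \<open>t\<^sup>q\<close>, the x-coordinate of \<open>P\<^sub>0\<close>, and \<open>n / (t\<^sup>q - t)\<^sup>2\<close>, that of \<open>P\<^sub>0 + Q\<close>, where
  \<open>n\<close> is the numerator given by the chord construction. Since
  \<open>t\<^sup>q - t\<close> is the product of all \<open>t - r\<close>, only these factors can cancel in the second fraction. The
  factor \<open>t - r\<close> cancels exactly as often as there are points of the curve above \<open>r\<close>: twice if \<open>f(r)\<close> is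
  a nonzero square, because then \<open>f\<^bsup>(q-1)/2\<^esup> - 1\<close> vanishes at \<open>r\<close>; once if \<open>f(r) = 0\<close>, because \<open>f\<close> is
  squarefree; never otherwise. So the reduced numerator has degree \<open>2 q + 1 - N\<close>.
\<close>

theorem hasse_bound_short:
  fixes a b :: "'a::{finite_field, field_gcd}"
  assumes prime_field: "CARD('a) = CHAR('a)"
    and two: "(2::'a) \<noteq> 0" and disc: "4 * a^3 + 27 * b^2 \<noteq> 0"
  defines "N \<equiv> card {(x, y). y^2 = x^3 + a * x + b}"
  shows "(int CARD('a) - int N)^2 \<le> 4 * int CARD('a)"
proof -
  define q where "q = CARD('a)"
  have prime_q: "prime q" and q_char: "q = CHAR('a)" and q_char_poly: "q = CHAR('a poly)"
    using prime_field by (simp_all add: q_def)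
  have "q \<noteq> 2"
    using two of_nat_CHAR[where ?'a = 'a] unfolding q_char[symmetric] by auto
  then have odd_q: "odd q"
    using prime_q prime_odd_nat prime_ge_2_nat[of q] by auto
  then obtain h where h: "q = 2 * h + 1"
    by (rule oddE)
  have h0: "h > 0"
    using h prime_ge_2_nat[OF prime_q] by simp

  let ?t = "[:0, 1:] :: 'a poly" and ?a = "[:a:]" and ?b = "[:b:]"
  define f where "f = ?t^3 + ?a * ?t + ?b"
  have f_eq: "f = [:b, a, 0, 1:]"
    by (simp add: f_def power3_eq_cube)
  have poly_f: "poly f r = r^3 + a * r + b" for r
    by (simp add: f_eq power3_eq_cube algebra_simps)
  have deg_f: "degree f = 3"
    by (simp add: f_eq)
  have f0: "f \<noteq> 0"
    by (simp add: f_eq)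
  define X where "X = ?t ^ q"
  have deg_X: "degree X = q"
    by (simp add: X_def degree_power_eq)
  have poly_X: "poly X r = r" for r
    using finite_field_power_card_eq_same[of r] by (simp add: X_def q_def)
  define y where "y = f ^ h"
  have curve: "f * y^2 = X^3 + ?a * X + ?b"
  proof -
    have "f * y^2 = f ^ q"
      by (simp add: y_def h power_add power_mult[symmetric] mult.commute)
    \<comment> \<open>Frobenius raises \<open>t\<close> to the power \<open>q\<close> and fixes the coefficients.\<close>
    also have "\<dots> = (?t^3) ^ q + (?a * ?t) ^ q + ?b ^ q"
      using prime_q unfolding f_def q_char_poly by (simp only: freshmans_dream)
    also have "?a ^ q = ?a" "?b ^ q = ?b"
      using finite_field_power_card_eq_same[of a] finite_field_power_card_eq_same[of b]
      by (simp_all add: q_def poly_const_pow)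
    then have "(?t^3) ^ q + (?a * ?t) ^ q + ?b ^ q = X^3 + ?a * X + ?b"
      by (simp only: X_def power_mult_distrib power_mult[symmetric] mult.commute[of 3])
    finally show ?thesis .
  qed
  define n where "n = f * (y - 1)^2 - (X + ?t) * (X - ?t)^2"

  \<comment> \<open>The number of points above \<open>r\<close>, which is also the multiplicity with which \<open>t - r\<close> cancels.\<close>
  define w where "w r = card {s. s^2 = poly f r}" for r
  have w: "w r = (if poly f r = 0 then 1 else if poly y r = 1 then 2 else 0)" for r
    unfolding w_def y_def poly_power by (rule card_square_roots) (use h two q_def in auto)
  have N: "N = (\<Sum>r\<in>UNIV. w r)"
  proof -
    have "{(x, y). y^2 = x^3 + a * x + b} = (SIGMA x:UNIV. {s. s^2 = poly f x})"
      by (auto simp: poly_f)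
    then show ?thesis
      unfolding N_def w_def by simp
  qed

  let ?L = "\<lambda>r. [:- r, 1:] :: 'a poly"
  \<comment> \<open>\<open>g\<close> is the part of the denominator \<open>(t\<^sup>q - t)\<^sup>2\<close> that cancels, and \<open>v\<close> is the part that remains.\<close>
  define g where "g = (\<Prod>r\<in>UNIV. ?L r ^ w r)"
  define v where "v = (\<Prod>r\<in>UNIV. ?L r ^ (2 - w r))"
  have w_le: "w r \<le> 2" for r
    by (simp add: w)
  have gv: "g * v = (X - ?t)^2"
  proof -
    have "g * v = (\<Prod>r\<in>UNIV. ?L r ^ w r * ?L r ^ (2 - w r))"
      by (simp add: g_def v_def prod.distrib)
    also have "\<dots> = (\<Prod>r\<in>UNIV. ?L r) ^ 2"
      using w_le by (simp only: power_add[symmetric] le_add_diff_inverse prod_power_distrib)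
    finally show ?thesis
      by (simp add: prod_linear_UNIV X_def q_def)
  qed
  have deg_g: "degree g = N"
    unfolding g_def N by (subst degree_prod_eq_sum_degree) (simp_all add: degree_linear_power)
  have g0: "g \<noteq> 0"
    by (simp add: g_def)

  have L_dvd: "?L r dvd X - ?t" for r
    by (simp add: poly_eq_0_iff_dvd[symmetric] poly_X)
  have poly_n: "poly n r = poly f r * (poly y r - 1)^2" for r
    by (simp add: n_def poly_X)
  have squarefree: "\<not> ?L r ^ 2 dvd f" for r
  proof
    assume "?L r ^ 2 dvd f"
    then obtain k where "f = ?L r ^ 2 * k"
      by (rule dvdE)
    then have k: "f = ?L r * (?L r * k)"
      by (simp only: power2_eq_square mult.assoc)
    have "poly f r = 0" "poly (pderiv f) r = 0"
      unfolding k pderiv_mult by simp_all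
    then have "r^3 + a * r + b = 0" "3 * r^2 + a = 0"
      unfolding poly_f by (simp_all add: f_eq pderiv_pCons power2_eq_square algebra_simps)
    then have "4 * a^3 + 27 * b^2 = 0"
      unfolding discriminant_bezout[of a b r] by simp
    then show False
      using disc by contradiction
  qed
  have n_dvd: "?L r ^ w r dvd n" for r
  proof -
    have "?L r ^ 2 dvd n" if "poly y r = 1"
    proof -
      have "?L r dvd y - 1"
        using that by (simp add: poly_eq_0_iff_dvd[symmetric])
      then show ?thesis
        using L_dvd[of r] unfolding n_def by (simp only: dvd_diff dvd_mult dvd_power_same)
    qed
    moreover have "?L r dvd n" if "poly f r = 0"
      using that by (simp add: poly_eq_0_iff_dvd[symmetric] poly_n)
    ultimately show ?thesis
      by (simp add: w)
  qed
  have n_not_dvd: "\<not> ?L r ^ Suc (w r) dvd n" if "w r < 2" for r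
  proof (cases "poly f r = 0")
    case True
    have y: "poly (y - 1) r \<noteq> 0"
      using True h0 by (simp add: y_def power_0_left)
    show ?thesis
    proof
      assume "?L r ^ Suc (w r) dvd n"
      then have "?L r ^ 2 dvd n"
        using True by (simp add: w numeral_2_eq_2)
      moreover have "?L r ^ 2 dvd (X + ?t) * (X - ?t)^2"
        using L_dvd[of r] by (simp only: dvd_mult dvd_power_same)
      moreover have "f * (y - 1)^2 = n + (X + ?t) * (X - ?t)^2"
        by (simp add: n_def)
      ultimately have "?L r ^ 2 dvd f * (y - 1)^2"
        by (metis dvd_add)
      moreover have "coprime (?L r ^ 2) ((y - 1)^2)"
        using y by (simp add: coprime_linear_iff)
      ultimately show False
        using squarefree by (simp add: coprime_dvd_mult_left_iff)
    qed
  next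
    case False
    then have "poly y r \<noteq> 1" "w r = 0"
      using that by (auto simp: w split: if_splits)
    then have "poly n r \<noteq> 0"
      using False by (simp add: poly_n)
    then show ?thesis
      using \<open>w r = 0\<close> by (simp add: poly_eq_0_iff_dvd)
  qed

  have "g dvd n"
    unfolding g_def
  proof (rule prod_dvd_of_coprime)
    show "coprime (?L r ^ w r) (?L s ^ w s)" if "r \<noteq> s" for r s
      using that by (simp add: coprime_linear_iff)
  qed (simp_all add: n_dvd)
  then obtain u where u: "n = g * u"
    by (rule dvdE)
  have "coprime u (?L r ^ (2 - w r))" for r
  proof (cases "w r < 2")
    case True
    have "\<not> ?L r dvd u"
    proof
      assume "?L r dvd u"
      moreover have "?L r ^ w r dvd g"
        unfolding g_def by (rule dvd_prodI) simp_all
      ultimately have "?L r ^ w r * ?L r dvd n"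
        unfolding u by (rule mult_dvd_mono[rotated])
      then show False
        using n_not_dvd[OF True] by (simp add: mult.commute)
    qed
    then show ?thesis
      by (simp add: coprime_commute[of u] coprime_linear_iff poly_eq_0_iff_dvd)
  qed simp
  then have coprime_uv: "coprime u v"
    unfolding v_def by (rule prod_coprime_right)

  have deg_n: "degree n = 2 * q + 1"
  proof -
    have fy: "f * y = f ^ Suc h"
      by (simp add: y_def)
    have split: "n = ?t * X^2 + ((?t^2 + ?a) * X + (?a * ?t + 2 * ?b) - 2 * (f * y))"
      using chord_numerator[OF curve[unfolded f_def]] unfolding n_def f_def
      by (simp only: algebra_simps power2_eq_square)
    have lead: "degree (?t * X^2) = 2 * q + 1"
      using h by (simp add: X_def degree_mult_eq degree_power_eq flip: power_mult)
    have "degree (2 * (f * y)) \<le> 3 * Suc h"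
      unfolding fy numeral_poly
      by (rule order.trans[OF degree_mult_le]) (simp add: degree_power_eq f0 deg_f del: power_Suc)
    moreover have "degree ((?t^2 + ?a) * X) \<le> q + 2"
      by (rule order.trans[OF degree_mult_le]) (simp add: deg_X power2_eq_square)
    moreover have "degree (?a * ?t + 2 * ?b) \<le> 1"
      by (simp add: numeral_poly)
    moreover have "3 * Suc h \<le> 2 * q" "q + 2 \<le> 2 * q" "1 \<le> 2 * q"
      using h h0 by simp_all
    ultimately have "degree ((?t^2 + ?a) * X + (?a * ?t + 2 * ?b) - 2 * (f * y)) \<le> 2 * q"
      by (intro degree_diff_le[OF degree_add_le]) linarith+
    then have "degree ((?t^2 + ?a) * X + (?a * ?t + 2 * ?b) - 2 * (f * y)) < degree (?t * X^2)"
      unfolding lead by linarith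
    then show ?thesis
      unfolding split lead[symmetric] by (rule degree_add_eq_left)
  qed
  have n0: "n \<noteq> 0" and u0: "u \<noteq> 0"
    using deg_n u by auto
  have deg_u: "degree u + N = 2 * q + 1"
    using deg_n g0 u0 by (simp add: u degree_mult_eq deg_g)
  have "degree (X - ?t) = q"
    unfolding diff_conv_add_uminus using deg_X h h0 by (subst degree_add_eq_left) simp_all
  moreover from this have "X - ?t \<noteq> 0"
    using h by auto
  ultimately have X_t: "X - ?t \<noteq> 0" "degree ((X - ?t)^2) = 2 * q"
    by (simp_all add: degree_power_eq)
  then have v0: "v \<noteq> 0"
    using gv by auto
  have deg_v: "degree v + N = 2 * q"
    using X_t(2) g0 v0 unfolding gv[symmetric] by (simp add: degree_mult_eq deg_g)

  have poles: "pole_at_infinity X 1" "pole_at_infinity u v"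
    using deg_X h u0 v0 deg_u deg_v by (auto simp: pole_at_infinity_def)
  have "biquad ?a ?b ?t X 1 (g * u) (g * v) = 0"
    using biquad_chord[OF curve[unfolded f_def]] unfolding gv u[symmetric] n_def f_def .
  then have root: "biquad ?a ?b ?t X 1 u v = 0"
    using g0 by (simp add: biquad_scale)
  have "(int q - int N)^2 \<le> 4 * int q"
  proof (rule quadratic_nonneg_on_ints_imp_disc_nonpos)
    show "odd (int q)"
      using odd_q by simp
    show "0 \<le> int q + (int q - int N) * int k + int k ^ 2" for k
    proof -
      have "0 \<le> int (degree X) + int k * (int (degree u) - int (degree X)) + int k * (int k - 1)"
        using poles coprime_uv root[unfolded biquad_commute[of _ _ _ X 1]]
        by (intro numerator_degrees_quadratic[OF two disc]) simp_all
      moreover have "int (degree u) = 2 * int q + 1 - int N"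
        using deg_u by linarith
      ultimately show ?thesis
        by (simp add: deg_X power2_eq_square algebra_simps)
    qed
    \<comment> \<open>The sequence in the opposite direction starts at \<open>P\<^sub>0 + Q\<close>, so it reaches \<open>P\<^sub>0 - k Q\<close> after \<open>k + 1\<close> steps.\<close>
    show "0 \<le> int q - (int q - int N) * int k + int k ^ 2" for k
    proof -
      have "0 \<le> int (degree u) + int (Suc k) * (int (degree X) - int (degree u))
          + int (Suc k) * (int (Suc k) - 1)"
        using poles coprime_uv root
        by (intro numerator_degrees_quadratic[OF two disc]) simp_all
      moreover have "int (degree u) = 2 * int q + 1 - int N"
        using deg_u by linarith
      ultimately show ?thesis
        by (simp add: deg_X power2_eq_square algebra_simps)
    qed
  qed
  then show ?thesis
    by (simp add: q_def)
qed

section \<open>Hasse's bound for general Weierstrass equations\<close>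

text \<open>
  Completing the square and the cube, with denominators cleared: \<open>A = - 27 c\<^sub>4\<close> and \<open>B = - 54 c\<^sub>6\<close> in the usual
  notation, and \<open>46656 = 6\<^sup>6\<close>.
\<close>

lemma short_form_identity:
  fixes x y a1 a2 a3 a4 a6 :: "'a::idom"
  defines "b2 \<equiv> a1^2 + 4 * a2" and "b4 \<equiv> 2 * a4 + a1 * a3" and "b6 \<equiv> a3^2 + 4 * a6"
  defines "A \<equiv> - (27 * (b2^2 - 24 * b4))" and "B \<equiv> - (54 * (36 * b2 * b4 - b2^3 - 216 * b6))"
  shows "(108 * (2 * y + a1 * x + a3))^2 - ((36 * x + 3 * b2)^3 + A * (36 * x + 3 * b2) + B)
    = 46656 * (y^2 + a1 * x * y + a3 * y - (x^3 + a2 * x^2 + a4 * x + a6))"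
  unfolding assms by (simp add: algebra_simps power_numeral_reduce)

text \<open>
  This is \<open>c\<^sub>4\<^sup>3 - c\<^sub>6\<^sup>2 = 1728 \<Delta>\<close> multiplied by \<open>- 4 \<sqdot> 27\<^sup>3\<close>; the constant \<open>136048896\<close> is \<open>2\<^sup>8 3\<^sup>1\<^sup>2\<close>, a unit in characteristic
  other than \<open>2\<close> and \<open>3\<close>.
\<close>

lemma short_form_discriminant:
  fixes b2 b4 b6 b8 :: "'a::idom"
  assumes "4 * b8 = b2 * b6 - b4^2"
  shows "4 * (- (27 * (b2^2 - 24 * b4)))^3 + 27 * (- (54 * (36 * b2 * b4 - b2^3 - 216 * b6)))^2
    = - (136048896 * (- (b2^2 * b8) - 8 * b4^3 - 27 * b6^2 + 9 * b2 * b4 * b6))" (is "?L = ?R")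
proof -
  have "?L - ?R = 34012224 * b2^2 * (b2 * b6 - b4^2 - 4 * b8)"
    by (simp add: algebra_simps power_numeral_reduce)
  then show ?thesis
    unfolding assms by simp
qed

theorem hasse_bound_weierstrass:
  fixes E :: "'a::{finite_field, field_gcd} weierstrass"
  assumes prime_field: "CARD('a) = CHAR('a)"
    and two: "(2::'a) \<noteq> 0" and three: "(3::'a) \<noteq> 0" and disc: "discriminant E \<noteq> 0"
  defines "N \<equiv> card {(x, y). weq E x y = 0}"
  shows "(int CARD('a) - int N)^2 \<le> 4 * int CARD('a)"
proof -
  define b2 where "b2 = wa1 E ^ 2 + 4 * wa2 E"
  define b4 where "b4 = 2 * wa4 E + wa1 E * wa3 E"
  define b6 where "b6 = wa3 E ^ 2 + 4 * wa6 E"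
  define b8 where "b8 = wa1 E ^ 2 * wa6 E + 4 * wa2 E * wa6 E - wa1 E * wa3 E * wa4 E
               + wa2 E * wa3 E ^ 2 - wa4 E ^ 2"
  define A where "A = - (27 * (b2^2 - 24 * b4))"
  define B where "B = - (54 * (36 * b2 * b4 - b2^3 - 216 * b6))"
  have smooth: "(2::'a) ^ i * 3 ^ j \<noteq> 0" for i j
    using two three by simp
  have units: "(136048896::'a) \<noteq> 0" "(46656::'a) \<noteq> 0" "(36::'a) \<noteq> 0" "(216::'a) \<noteq> 0"
    using smooth[of 8 12] smooth[of 6 6] smooth[of 2 2] smooth[of 3 3] by simp_all
  have "4 * b8 = b2 * b6 - b4^2"
    unfolding b2_def b4_def b6_def b8_def by (simp add: algebra_simps power2_eq_square)
  then have "4 * A^3 + 27 * B^2 = - (136048896 * discriminant E)"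
    unfolding A_def B_def discriminant_def Let_def
      b2_def[symmetric] b4_def[symmetric] b6_def[symmetric] b8_def[symmetric]
    by (rule short_form_discriminant)
  then have short_disc: "4 * A^3 + 27 * B^2 \<noteq> 0"
    using disc units by simp
  define X where "X x = 36 * x + 3 * b2" for x
  define Y where "Y x y = 108 * (2 * y + wa1 E * x + wa3 E)" for x y
  have weq_iff: "weq E x y = 0 \<longleftrightarrow> (Y x y)^2 = (X x)^3 + A * X x + B" for x y
  proof -
    have "(Y x y)^2 - ((X x)^3 + A * X x + B) = 46656 * weq E x y"
      unfolding X_def Y_def A_def B_def weq_def b2_def b4_def b6_def by (rule short_form_identity)
    then show ?thesis
      using units(2) by (metis mult_eq_0_iff right_minus_eq)
  qed
  have inv: "36 * ((x - 3 * b2) / 36) = x - 3 * b2" "216 * (z / 216) = z" for x z :: 'a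
    using units by simp_all
  have "bij_betw (\<lambda>(x, y). (X x, Y x y)) {(x, y). weq E x y = 0} {(x, y). y^2 = x^3 + A * x + B}"
    (is "bij_betw ?\<phi> ?S ?T")
  proof (rule bij_betwI')
    fix P Q
    assume "P \<in> ?S" "Q \<in> ?S"
    obtain x y x' y' where PQ: "P = (x, y)" "Q = (x', y')"
      by (metis prod.exhaust)
    have "x = x'" if "X x = X x'"
      using that units(3) by (simp add: X_def)
    moreover have "y = y'" if "Y x y = Y x y'"
    proof -
      have "216 * y = 216 * y'"
        using that by (simp add: Y_def algebra_simps)
      then show ?thesis
        using units(4) by simp
    qed
    ultimately show "(?\<phi> P = ?\<phi> Q) = (P = Q)"
      unfolding PQ by auto
  next
    fix P
    assume "P \<in> ?S"
    then show "?\<phi> P \<in> ?T"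
      using weq_iff by auto
  next
    fix Q
    assume Q: "Q \<in> ?T"
    obtain x y where xy: "Q = (x, y)"
      by (metis prod.exhaust)
    define x' where "x' = (x - 3 * b2) / 36"
    define y' where "y' = (y - 108 * (wa1 E * x' + wa3 E)) / 216"
    have "X x' = x"
      unfolding X_def x'_def inv(1) by simp
    moreover have "Y x' y' = y"
    proof -
      have "Y x' y' = 216 * y' + 108 * (wa1 E * x' + wa3 E)"
        by (simp add: Y_def algebra_simps)
      then show ?thesis
        unfolding y'_def inv(2) by simp
    qed
    ultimately have "(x', y') \<in> ?S" "Q = ?\<phi> (x', y')"
      using Q weq_iff[of x' y'] unfolding xy by auto
    then show "\<exists>P\<in>?S. Q = ?\<phi> P"
      by (rule bexI[rotated])
  qed
  then have "N = card {(x, y). y^2 = x^3 + A * x + B}"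
    unfolding N_def by (rule bij_betw_same_card)
  then show ?thesis
    using hasse_bound_short[OF prime_field two short_disc] by simp
qed

section \<open>Hasse's bound for reductions of integral equations\<close>

lemma hasse_bound_card_type:
  fixes E :: "int weierstrass"
  assumes "5 \<le> CARD('c::prime_card)" and good: "good_reduction E CARD('c)"
  shows "(a_prime E CARD('c))^2 \<le> 4 * int CARD('c)"
proof -
  let ?p = "CARD('c)"
  define E' where "E' = map_weierstrass (of_int :: int \<Rightarrow> 'c mod_ring) E"
  have zero_iff: "of_int k = (0 :: 'c mod_ring) \<longleftrightarrow> int ?p dvd k" for k
    by (simp add: of_int_eq_0_iff_char_dvd)
  have weq: "weq E' (of_int x) (of_int y) = of_int (weq E x y)" for x y
    by (simp add: E'_def weq_def weierstrass.map_sel)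
  have "discriminant E' = of_int (discriminant E)"
    by (simp add: E'_def discriminant_def Let_def weierstrass.map_sel)
  then have disc: "discriminant E' \<noteq> 0"
    using good by (simp add: zero_iff good_reduction_def)
  have "\<not> int ?p dvd 2" "\<not> int ?p dvd 3"
    using assms(1) by (auto dest: zdvd_imp_le)
  then have units: "(2 :: 'c mod_ring) \<noteq> 0" "(3 :: 'c mod_ring) \<noteq> 0"
    using zero_iff[of 2] zero_iff[of 3] by simp_all
  have range: "to_int_mod_ring z \<in> {0..<int ?p}" for z :: "'c mod_ring"
    using range_to_int_mod_ring[where ?'a = 'c] by blast
  have inv: "of_int (to_int_mod_ring z) = z" for z :: "'c mod_ring"
    by (simp add: of_int_of_int_mod_ring)
  have inv': "to_int_mod_ring (of_int k :: 'c mod_ring) = k" if "0 \<le> k" "k < int ?p" for k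
    using that by (simp add: of_int_of_int_mod_ring)
  have "bij_betw (map_prod of_int of_int)
      {(x, y). x \<in> {0..<int ?p} \<and> y \<in> {0..<int ?p} \<and> int ?p dvd weq E x y}
      {(x, y). weq E' x y = 0}"
  proof (rule bij_betwI)
    show "map_prod to_int_mod_ring to_int_mod_ring \<in> {(x, y). weq E' x y = 0}
        \<rightarrow> {(x, y). x \<in> {0..<int ?p} \<and> y \<in> {0..<int ?p} \<and> int ?p dvd weq E x y}"
    proof
      fix z :: "'c mod_ring \<times> 'c mod_ring"
      assume z: "z \<in> {(x, y). weq E' x y = 0}"
      obtain x y where xy: "z = (x, y)"
        by (rule prod.exhaust)
      have "int ?p dvd weq E (to_int_mod_ring x) (to_int_mod_ring y)"
        using z unfolding xy zero_iff[symmetric] weq[symmetric] inv by simp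
      then show "map_prod to_int_mod_ring to_int_mod_ring z
          \<in> {(x, y). x \<in> {0..<int ?p} \<and> y \<in> {0..<int ?p} \<and> int ?p dvd weq E x y}"
        unfolding xy using range[of x] range[of y] by simp
    qed
  qed (auto simp: weq zero_iff inv inv')
  then have "num_points E ?p = 1 + card {(x, y). weq E' x y = 0}"
    unfolding num_points_def by (simp add: bij_betw_same_card)
  then have "a_prime E ?p = int ?p - int (card {(x, y). weq E' x y = 0})"
    using good by (simp add: a_prime_def)
  then show ?thesis
    using hasse_bound_weierstrass[OF _ units disc] by simp
qed

text \<open>
  The bound is available for the primes that are the cardinality of some type, while no type can
  depend on a variable \<open>p\<close>. But a single type suffices: choose, if Hasse's bound fails at all, a prime where it fails,
  and apply the bound to a type with that many elements.
\<close>

definition violates_hasse :: "nat \<Rightarrow> bool" where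
  "violates_hasse p \<longleftrightarrow> prime p \<and> 5 \<le> p \<and>
     (\<exists>E. good_reduction E p \<and> \<not> (a_prime E p)^2 \<le> 4 * int p)"

definition critical_prime :: nat where
  "critical_prime = (if Ex violates_hasse then Eps violates_hasse else 2)"

lemma prime_critical_prime: "prime critical_prime"
proof (cases "Ex violates_hasse")
  case True
  then have "violates_hasse critical_prime"
    unfolding critical_prime_def by (simp add: someI_ex)
  then show ?thesis
    by (simp add: violates_hasse_def)
next
  case False
  then have "critical_prime = 2"
    unfolding critical_prime_def by (rule if_not_P)
  then show ?thesis
    by (metis two_is_prime_nat)
qed

typedef critical_index = "{..<critical_prime}"
  using prime_gt_0_nat[OF prime_critical_prime] by blast

lemma card_critical_index: "CARD(critical_index) = critical_prime"
  using type_definition.card[OF type_definition_critical_index] by simp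

instance critical_index :: prime_card
  by standard (simp add: card_critical_index prime_critical_prime)

theorem hasse_bound:
  assumes "prime p" and "5 \<le> p" and "good_reduction E p"
  shows "(a_prime E p)^2 \<le> 4 * int p"
proof (rule ccontr)
  assume "\<not> (a_prime E p)^2 \<le> 4 * int p"
  then have "Ex violates_hasse"
    using assms unfolding violates_hasse_def by blast
  then have "violates_hasse critical_prime"
    unfolding critical_prime_def by (simp add: someI_ex)
  then show False
    using hasse_bound_card_type[where ?'c = critical_index]
    unfolding violates_hasse_def card_critical_index by blast
qed

section \<open>Elliptic Korselt numbers\<close>

lemma signs_of_unit_product:
  fixes c :: "'i \<Rightarrow> int"
  assumes "finite S" and "prod c S = 1"
  shows "\<And>i. i \<in> S \<Longrightarrow> c i = 1 \<or> c i = -1" and "even (card {i \<in> S. c i = -1})"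
proof -
  show unit: "c i = 1 \<or> c i = -1" if "i \<in> S" for i
    using dvd_prodI[OF assms(1) that, of c] assms(2) by (simp add: abs_eq_iff' zdvd1_eq)
  have "prod c S = (\<Prod>i\<in>S. if c i = -1 then -1 else 1)"
    using unit by (intro prod.cong) auto
  also have "\<dots> = (-1) ^ card {i \<in> S. c i = -1}"
    using assms(1) by (simp add: prod.If_cases Int_def)
  finally show "even (card {i \<in> S. c i = -1})"
    using assms(2) by (cases "even (card {i \<in> S. c i = -1})") auto
qed

text \<open>
  In the application \<open>K = 4\<^sup>m\<close>, and the bounds on \<open>P\<close> say that the first and the third alternative fail. The
  bound \<open>4 A\<^sup>2 \<le> 4\<^sup>m P\<close> is four times the product of Hasse's bounds for the \<open>m - 1\<close> smaller primes.
\<close>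

lemma large_prime_dichotomy:
  fixes P q a A :: int and K :: nat
  assumes K: "16 \<le> K" and P: "int K < P" and q: "(int K * P)^2 < q"
    and a: "a^2 \<le> 4 * q" and A: "4 * A^2 \<le> int K * P"
    and dvd: "q + 1 - a dvd P * q + 1 - A * a"
  shows "a = 1 \<and> A = 1"
proof -
  have P16: "16 < P" and P0: "0 < P"
    using K P by linarith+
  have "(2 * A)^2 < P^2"
    using A mult_strict_right_mono[OF P P0] by (simp add: power2_eq_square)
  then have A_small: "2 * \<bar>A\<bar> < P"
    using P0 abs_le_square_iff[of P "2 * A"] by (simp add: abs_mult not_le[symmetric] del: not_le)
  define R where "R = P * (a - 1) + 1 - A * a"
  have "P * q + 1 - A * a = P * (q + 1 - a) + R"
    by (simp add: R_def algebra_simps)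
  then have R_dvd: "q + 1 - a dvd R"
    using dvd by (simp add: dvd_add_right_iff)
  \<comment> \<open>With \<open>s = \<surd>q\<close>, a nonzero \<open>R\<close> would give \<open>s\<^sup>2 < (4 P + 3) s\<close> although \<open>s > 16 P\<close>.\<close>
  have "R = 0"
  proof (rule ccontr)
    assume "R \<noteq> 0"
    define s where "s = sqrt (real_of_int q)"
    have "(16 * P)^2 \<le> (int K * P)^2"
      using K P0 by (intro power_mono mult_right_mono) auto
    then have "(16 * P)^2 < q"
      using q by linarith
    then have s: "16 * real_of_int P < s"
      unfolding s_def by (intro real_less_rsqrt) (metis of_int_less_iff of_int_mult of_int_numeral of_int_power)
    have s2: "s^2 = q"
      using q unfolding s_def by (smt (verit) of_int_0_le_iff real_sqrt_pow2 zero_le_power2)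
    have "real_of_int (a^2) \<le> real_of_int (4 * q)"
      using a by (simp only: of_int_le_iff)
    then have "(real_of_int a)^2 \<le> (2 * s)^2"
      by (simp add: power_mult_distrib s2)
    then have a_le: "\<bar>real_of_int a\<bar> \<le> 2 * s"
      using s P0 abs_le_square_iff[of "real_of_int a" "2 * s"] by simp
    have "\<bar>q + 1 - a\<bar> \<le> \<bar>R\<bar>"
      using R_dvd \<open>R \<noteq> 0\<close> by (rule dvd_imp_le_int[rotated])
    then have "q + 1 - a \<le> \<bar>R\<bar>"
      by linarith
    also have "R = (P - A) * a - (P - 1)"
      by (simp add: R_def algebra_simps)
    also have "\<bar>(P - A) * a - (P - 1)\<bar> \<le> \<bar>P - A\<bar> * \<bar>a\<bar> + P"
      using abs_triangle_ineq4[of "(P - A) * a" "P - 1"] P0 by (simp add: abs_mult)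
    also have "\<dots> \<le> 2 * P * \<bar>a\<bar> + P"
      using A_small by (intro add_right_mono mult_right_mono) auto
    finally have "q + 1 \<le> (2 * P + 1) * \<bar>a\<bar> + P"
      by (simp add: algebra_simps)
    then have "real_of_int (q + 1) \<le> real_of_int ((2 * P + 1) * \<bar>a\<bar> + P)"
      by (simp only: of_int_le_iff)
    then have "real_of_int q + 1 \<le> (2 * P + 1) * \<bar>real_of_int a\<bar> + P"
      by simp
    also have "\<dots> \<le> (2 * P + 1) * (2 * s) + P"
      using a_le P0 by (intro add_right_mono mult_left_mono) auto
    also have "\<dots> \<le> s * s"
    proof -
      have "(2 * P + 1) * (2 * s) + P \<le> (4 * P + 3) * s"
        using s P0 by (simp add: algebra_simps)
      also have "\<dots> \<le> s * s"
        using s P16 by (intro mult_right_mono) auto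
      finally show ?thesis .
    qed
    finally show False
      using s2 by (simp add: power2_eq_square)
  qed
  then have eq: "a * (P - A) = P - 1"
    by (simp add: R_def algebra_simps)
  have A_pos_bound: "2 * A < P"
    using A_small by (rule le_less_trans[rotated]) simp
  then have "0 < P - A"
    using P0 by linarith
  moreover have "0 < P - 1"
    using P16 by linarith
  ultimately have "0 < a"
    using eq by (metis zero_less_mult_pos2)
  moreover have "a < 2"
  proof (rule ccontr)
    assume "\<not> a < 2"
    then have "2 * (P - A) \<le> a * (P - A)"
      using \<open>0 < P - A\<close> by (intro mult_right_mono) auto
    then show False
      using A_pos_bound unfolding eq by arith
  qed
  ultimately have "a = 1"
    by linarith
  then show ?thesis
    using eq by simp
qed

theorem theorem2p5:
  fixes E :: "int weierstrass" and m n :: nat and p :: "nat \<Rightarrow> nat"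
  assumes "minimal_elliptic_curve E"
    and "m \<ge> 2"
    and "\<And>i. i \<in> {1..m} \<Longrightarrow> prime (p i)"
    and "5 \<le> p 1"
    and "strict_mono_on {1..m} p"
    and "n = (\<Prod>i=1..m. p i)"
    and "elliptic_korselt_I E n"
  shows "(\<Prod>i=1..m-1. p i) \<le> 4 ^ m
    \<or> (a_prime E (p m) = 1 \<and>
        even (card {i \<in> {1..m-1}. a_prime E (p i) = -1}) \<and>
        (\<forall>i \<in> {1..m-1}. a_prime E (p i) \<noteq> -1 \<longrightarrow> a_prime E (p i) = 1))
    \<or> real (\<Prod>i=1..m-1. p i) \<ge> sqrt (real (p m)) / 4 ^ m"
proof (rule ccontr)
  assume neg: "\<not> ?thesis"
  define c where "c i = a_prime E (p i)" for i
  define P where "P = (\<Prod>i=1..m-1. p i)"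
  define A where "A = (\<Prod>i=1..m-1. c i)"
  have split: "{1..m} = insert m {1..m-1}"
    using assms(2) by auto
  have n: "n = P * p m"
    using assms(2) unfolding assms(6) split P_def by simp
  have dvd_n: "p i dvd n" if "i \<in> {1..m}" for i
    using that unfolding assms(6) by (intro dvd_prodI) simp_all
  have local: "good_reduction E (p i)" "int (p i) + 1 - c i dvd int n + 1 - a_coeff E n"
    if "i \<in> {1..m}" for i
    using assms(3,7) dvd_n that unfolding elliptic_korselt_I_def c_def by blast+
  have ge5: "5 \<le> p i" if "i \<in> {1..m}" for i
  proof -
    have "p 1 \<le> p i"
      using that assms(2) by (intro strict_mono_on_leD[OF assms(5)]) auto
    then show ?thesis
      using assms(4) by linarith
  qed
  have hasse: "(c i)^2 \<le> 4 * int (p i)" if "i \<in> {1..m}" for i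
    unfolding c_def using that assms(3) ge5 local(1) by (intro hasse_bound) auto
  have "a_coeff E n = (\<Prod>i\<in>{1..m}. c i)"
  proof -
    have inj: "inj_on p {1..m}"
      using assms(5) by (rule strict_mono_on_imp_inj_on)
    have "n = \<Prod>(p ` {1..m})"
      unfolding assms(6) using prod.reindex[OF inj, of "\<lambda>x. x"] by simp
    moreover have "a_coeff E (\<Prod>(p ` {1..m})) = (\<Prod>q\<in>p ` {1..m}. a_prime E q)"
      by (rule a_coeff_prod_primes) (use assms(3) in auto)
    ultimately show ?thesis
      by (simp only: prod.reindex[OF inj] o_def c_def)
  qed
  then have coeff: "a_coeff E n = A * c m"
    using assms(2) unfolding split A_def by (simp add: mult.commute)

  have "c m = 1 \<and> A = 1"
  proof (rule large_prime_dichotomy)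
    show "16 \<le> (4::nat) ^ m"
      using power_increasing[OF assms(2), of "4::nat"] by simp
    show "int (4 ^ m) < int P"
      using neg by (simp only: P_def of_nat_less_iff not_le de_Morgan_disj)
    show "(int (4 ^ m) * int P)^2 < int (p m)"
    proof -
      have "real P * 4 ^ m < sqrt (real (p m))"
        using neg by (simp add: P_def field_simps not_le)
      then have "(real P * 4 ^ m)^2 < real (p m)"
        using power_strict_mono[of "real P * 4 ^ m" "sqrt (real (p m))" 2] by simp
      then have "real ((4 ^ m * P)^2) < real (p m)"
        by (simp add: mult.commute)
      then have "(4 ^ m * P)^2 < p m"
        by (simp only: of_nat_less_iff)
      then show ?thesis
        by (metis of_nat_less_iff of_nat_mult of_nat_power)
    qed
    show "(c m)^2 \<le> 4 * int (p m)"
      using assms(2) by (intro hasse) auto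
    show "4 * A^2 \<le> int (4 ^ m) * int P"
    proof -
      have "A^2 = (\<Prod>i=1..m-1. (c i)^2)"
        by (simp add: A_def prod_power_distrib)
      also have "\<dots> \<le> (\<Prod>i=1..m-1. 4 * int (p i))"
        using hasse by (intro prod_mono) auto
      also have "\<dots> = 4 ^ (m - 1) * int P"
        by (simp add: prod.distrib P_def)
      finally have "4 * A^2 \<le> 4 ^ Suc (m - 1) * int P"
        by simp
      then show ?thesis
        using assms(2) by simp
    qed
    show "int (p m) + 1 - c m dvd int P * int (p m) + 1 - A * c m"
      using local(2)[of m] assms(2) unfolding coeff unfolding n by simp
  qed
  then have "prod c {1..m-1} = 1" and last: "a_prime E (p m) = 1"
    by (simp_all add: A_def c_def)
  note signs_of_unit_product[OF finite_atLeastAtMost this(1)]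
  then show False
    using neg last unfolding c_def by blast
qed

end
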